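(* Let $H$ be a separable complex Hilbert space, let $T\in\mathcal{B}(H)$ be a unitary operator that generates a $C^*$-algebra $\mathcal{A}$, and let $\mathcal{G}=\{T\}$. Then $\mathcal{G}$ is a hyperrigid generator for the $C^*$-algebra $\mathcal{A}$.
   Context: Here $\mathcal{A}$ is the $C^*$-subalgebra of $\mathcal{B}(H)$ generated by $T$. UCP means unital completely positive. A finite or countably infinite set $\mathcal{G}$ of generators of a $C^*$-algebra $\mathcal{A}$ is called hyperrigid (a hyperrigid generator for $\mathcal{A}$) if for every faithful representation $\mathcal{A}\subseteq\mathcal{B}(L)$ on a Hilbert space $L$ and every sequence of UCP maps $\phi_n:\mathcal{B}(L)\to\mathcal{B}(L)$, $n=1,2,\dots$, $$\lim_{n\to\infty}\|\phi_n(g)-g\|=0\ \ \forall g\in\mathcal{G}\ \Longrightarrow\ \lim_{n\to\infty}\|\phi_n(a)-a\|=0\ \ \forall a\in\mathcal{A}.$$ Representations of unital $C^*$-algebras are understood to be nondegenerate (unital). *)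

theory Defs
  imports "HOL-Analysis.Analysis"
begin

section \<open>Complex Hilbert spaces\<close>

class complex_vector = real_vector +
  fixes scaleC :: "complex \<Rightarrow> 'a \<Rightarrow> 'a"  (infixr \<open>*\<^sub>C\<close> 75)
  assumes scaleC_add_right: "c *\<^sub>C (x + y) = c *\<^sub>C x + c *\<^sub>C y"
    and scaleC_add_left: "(c + d) *\<^sub>C x = c *\<^sub>C x + d *\<^sub>C x"
    and scaleC_scaleC: "c *\<^sub>C d *\<^sub>C x = (c * d) *\<^sub>C x"
    and scaleC_of_real: "complex_of_real r *\<^sub>C x = r *\<^sub>R x"

text \<open>The real inner product of the library is the real part of the complex one; since
  \<^term>\<open>cinner x x\<close> is real by conjugate symmetry, positive definiteness and
  \<^prop>\<open>norm x = sqrt (Re (cinner x x))\<close> are inherited from \<^class>\<open>real_inner\<close>.\<close>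

class complex_inner = complex_vector + real_inner +
  fixes cinner :: "'a \<Rightarrow> 'a \<Rightarrow> complex"
  assumes cinner_commute: "cinner x y = cnj (cinner y x)"
    and cinner_add_left: "cinner (x + y) z = cinner x z + cinner y z"
    and cinner_scaleC_left: "cinner (c *\<^sub>C x) y = c * cinner x y"
    and inner_eq_Re_cinner: "inner x y = Re (cinner x y)"

class chilbert_space = complex_inner + complete_space

instantiation complex :: chilbert_space
begin
definition scaleC_complex :: "complex \<Rightarrow> complex \<Rightarrow> complex" where "scaleC_complex c x = c * x"
definition cinner_complex :: "complex \<Rightarrow> complex \<Rightarrow> complex" where "cinner_complex x y = x * cnj y"
instance
  by standard (simp_all add: scaleC_complex_def cinner_complex_def inner_complex_def
      algebra_simps scaleR_conv_of_real)
end

definition clinear :: "('a::complex_vector \<Rightarrow> 'b::complex_vector) \<Rightarrow> bool" where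
  "clinear f \<longleftrightarrow> (\<forall>x y. f (x + y) = f x + f y) \<and> (\<forall>c x. f (c *\<^sub>C x) = c *\<^sub>C f x)"

lemma scaleC_zero_right [simp]: "c *\<^sub>C (0::'a::complex_vector) = 0"
  using scaleC_add_right[of c 0 "0::'a"] by simp

lemma scaleC_minus_right: "c *\<^sub>C (- x) = - (c *\<^sub>C (x::'a::complex_vector))"
  using scaleC_add_right[of c x "- x"] by (simp add: minus_unique)

lemma scaleC_diff_right: "c *\<^sub>C (x - y) = c *\<^sub>C x - c *\<^sub>C (y::'a::complex_vector)"
  using scaleC_add_right[of c x "- y"] by (simp add: scaleC_minus_right)

lemma scaleC_scaleR_commute: "c *\<^sub>C r *\<^sub>R x = r *\<^sub>R c *\<^sub>C (x::'a::complex_vector)"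
  by (simp flip: scaleC_of_real add: scaleC_scaleC mult.commute)

lemma norm_scaleC: "norm (c *\<^sub>C x) = cmod c * norm (x::'a::complex_inner)"
proof -
  have "cinner x (c *\<^sub>C x) = cnj c * cinner x x"
    by (metis cinner_commute cinner_scaleC_left complex_cnj_mult)
  then have "inner (c *\<^sub>C x) (c *\<^sub>C x) = Re ((c * cnj c) * cinner x x)"
    by (simp add: inner_eq_Re_cinner cinner_scaleC_left mult.assoc)
  also have "\<dots> = (cmod c)\<^sup>2 * inner x x"
    by (simp add: complex_norm_square[symmetric] inner_eq_Re_cinner del: of_real_power)
  finally show ?thesis
    by (simp add: norm_eq_sqrt_inner real_sqrt_mult)
qed


section \<open>The algebra of bounded operators on a Hilbert space\<close>

typedef (overloaded) 'a bop =
  "{A :: 'a::chilbert_space \<Rightarrow>\<^sub>L 'a. \<forall>c x. blinfun_apply A (c *\<^sub>C x) = c *\<^sub>C blinfun_apply A x}"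
  morphisms blinfun_of_bop Bop
  by (rule exI[of _ 0]) simp

setup_lifting type_definition_bop

definition bop_apply :: "'a::chilbert_space bop \<Rightarrow> 'a \<Rightarrow> 'a"  (infixr \<open>\<cdot>\<close> 75) where
  "A \<cdot> x = blinfun_apply (blinfun_of_bop A) x"

instantiation bop :: (chilbert_space) real_normed_vector
begin
lift_definition zero_bop :: "'a bop" is 0 by simp
lift_definition plus_bop :: "'a bop \<Rightarrow> 'a bop \<Rightarrow> 'a bop" is "(+)"
  by (simp add: plus_blinfun.rep_eq scaleC_add_right)
lift_definition minus_bop :: "'a bop \<Rightarrow> 'a bop \<Rightarrow> 'a bop" is "(-)"
  by (simp add: minus_blinfun.rep_eq scaleC_diff_right)
lift_definition uminus_bop :: "'a bop \<Rightarrow> 'a bop" is uminus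
  by (simp add: uminus_blinfun.rep_eq scaleC_minus_right)
lift_definition scaleR_bop :: "real \<Rightarrow> 'a bop \<Rightarrow> 'a bop" is scaleR
  by (simp add: scaleR_blinfun.rep_eq scaleC_scaleR_commute)
lift_definition norm_bop :: "'a bop \<Rightarrow> real" is norm .
definition dist_bop :: "'a bop \<Rightarrow> 'a bop \<Rightarrow> real" where "dist_bop A B = norm (A - B)"
definition sgn_bop :: "'a bop \<Rightarrow> 'a bop" where "sgn_bop A = scaleR (inverse (norm A)) A"
definition [code del]:
  "(uniformity :: ('a bop \<times> 'a bop) filter) = (INF e\<in>{0<..}. principal {(A, B). dist A B < e})"
definition open_bop :: "'a bop set \<Rightarrow> bool" where [code del]:
  "open_bop S = (\<forall>A\<in>S. \<forall>\<^sub>F (A', B) in uniformity. A' = A \<longrightarrow> B \<in> S)"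
instance
proof
  fix A B :: "'a bop" and S :: "'a bop set"
  show "dist A B = norm (A - B)" by (rule dist_bop_def)
  show "sgn A = scaleR (inverse (norm A)) A" by (rule sgn_bop_def)
  show "(uniformity :: ('a bop \<times> 'a bop) filter) =
      (INF e\<in>{0<..}. principal {(A, B). dist A B < e})" by (rule uniformity_bop_def)
  show "open S = (\<forall>A\<in>S. \<forall>\<^sub>F (A', B) in uniformity. A' = A \<longrightarrow> B \<in> S)" by (rule open_bop_def)
qed (transfer; simp add: algebra_simps norm_triangle_ineq)+
end

lemma bounded_linear_scaleC: "bounded_linear (\<lambda>x. c *\<^sub>C (x::'a::complex_inner))"
  by (rule bounded_linear_intro[where K = "cmod c"])
    (simp_all add: scaleC_add_right scaleC_scaleR_commute norm_scaleC mult.commute)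

instantiation bop :: (chilbert_space) complex_vector
begin
lift_definition scaleC_bop :: "complex \<Rightarrow> 'a bop \<Rightarrow> 'a bop"
  is "\<lambda>c A. Blinfun (\<lambda>x. c *\<^sub>C x) o\<^sub>L A"
  by (simp add: bounded_linear_Blinfun_apply[OF bounded_linear_scaleC] scaleC_scaleC mult.commute)
instance
  by standard
    (transfer; rule blinfun_eqI; simp add: bounded_linear_Blinfun_apply[OF bounded_linear_scaleC]
      plus_blinfun.rep_eq scaleR_blinfun.rep_eq
      scaleC_add_right scaleC_add_left scaleC_scaleC scaleC_of_real)+
end

instantiation bop :: (chilbert_space) "{real_normed_algebra, monoid_mult}"
begin
lift_definition times_bop :: "'a bop \<Rightarrow> 'a bop \<Rightarrow> 'a bop" is "(o\<^sub>L)"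
  by simp
lift_definition one_bop :: "'a bop" is id_blinfun
  by simp
instance
proof
  fix A B :: "'a bop"
  show "norm (A * B) \<le> norm A * norm B"
    by transfer (rule norm_blinfun_compose)
qed (transfer; rule blinfun_eqI;
    simp add: plus_blinfun.rep_eq scaleR_blinfun.rep_eq blinfun.add_right blinfun.scaleR_right)+
end

lemma bop_eqI: "(\<And>x. A \<cdot> x = B \<cdot> x) \<Longrightarrow> A = B"
  by (metis bop_apply_def blinfun_eqI blinfun_of_bop_inject)

lemma bop_apply_simps [simp]:
  "0 \<cdot> x = 0" "(A + B) \<cdot> x = A \<cdot> x + B \<cdot> x" "(A - B) \<cdot> x = A \<cdot> x - B \<cdot> x"
  "(- A) \<cdot> x = - (A \<cdot> x)" "(r *\<^sub>R A) \<cdot> x = r *\<^sub>R (A \<cdot> x)" "(c *\<^sub>C A) \<cdot> x = c *\<^sub>C (A \<cdot> x)"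
  "(A * B) \<cdot> x = A \<cdot> B \<cdot> x" "1 \<cdot> x = x"
  by (simp_all add: bop_apply_def zero_bop.rep_eq plus_bop.rep_eq minus_bop.rep_eq
      uminus_bop.rep_eq scaleR_bop.rep_eq scaleC_bop.rep_eq times_bop.rep_eq one_bop.rep_eq
      plus_blinfun.rep_eq minus_blinfun.rep_eq uminus_blinfun.rep_eq scaleR_blinfun.rep_eq
      bounded_linear_Blinfun_apply[OF bounded_linear_scaleC])

lemma bounded_linear_bop_apply: "bounded_linear (\<lambda>x. A \<cdot> x)"
  unfolding bop_apply_def by (rule blinfun.bounded_linear_right)

lemma bop_apply_scaleC: "A \<cdot> (c *\<^sub>C x) = c *\<^sub>C (A \<cdot> x)"
  using blinfun_of_bop[of A] by (simp add: bop_apply_def)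

lemma norm_bop_eq_onorm: "norm A = onorm (\<lambda>x. A \<cdot> x)"
  by (simp add: norm_bop.rep_eq norm_blinfun.rep_eq bop_apply_def)

text \<open>Existence of the adjoint is the Riesz representation theorem (uniqueness is immediate).\<close>

definition adj :: "'a::chilbert_space bop \<Rightarrow> 'a bop" where
  "adj A = (THE B. \<forall>x y. cinner (A \<cdot> x) y = cinner x (B \<cdot> y))"

definition unitary :: "'a::chilbert_space bop \<Rightarrow> bool" where
  "unitary U \<longleftrightarrow> adj U * U = 1 \<and> U * adj U = 1"


section \<open>Concrete C*-algebras and their representations\<close>

text \<open>A C*-subalgebra need not contain the identity operator.\<close>

definition cstar_subalgebra :: "'a::chilbert_space bop set \<Rightarrow> bool" where
  "cstar_subalgebra \<A> \<longleftrightarrow> 0 \<in> \<A> \<and> (\<forall>a\<in>\<A>. \<forall>b\<in>\<A>. a + b \<in> \<A> \<and> a * b \<in> \<A>) \<and>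
     (\<forall>c. \<forall>a\<in>\<A>. c *\<^sub>C a \<in> \<A>) \<and> (\<forall>a\<in>\<A>. adj a \<in> \<A>) \<and> closed \<A>"

definition cstar_generated :: "'a::chilbert_space bop set \<Rightarrow> 'a bop set" where
  "cstar_generated \<G> = cstar_subalgebra hull \<G>"

text \<open>Only the values of \<open>\<pi>\<close> on \<open>\<A>\<close> matter. In the nondegeneracy clause the real span is already
  the complex span, because \<open>\<pi> a \<cdot> x\<close> may be replaced by \<open>\<pi> a \<cdot> (c *\<^sub>C x)\<close>.\<close>

definition representation_on ::
    "'a::chilbert_space bop set \<Rightarrow> ('a bop \<Rightarrow> 'b::chilbert_space bop) \<Rightarrow> bool" where
  "representation_on \<A> \<pi> \<longleftrightarrow>
     (\<forall>a\<in>\<A>. \<forall>b\<in>\<A>. \<pi> (a + b) = \<pi> a + \<pi> b \<and> \<pi> (a * b) = \<pi> a * \<pi> b) \<and>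
     (\<forall>c. \<forall>a\<in>\<A>. \<pi> (c *\<^sub>C a) = c *\<^sub>C \<pi> a) \<and>
     (\<forall>a\<in>\<A>. \<pi> (adj a) = adj (\<pi> a)) \<and>
     closure (span {\<pi> a \<cdot> x | a x. a \<in> \<A>}) = UNIV"

definition faithful_representation_on ::
    "'a::chilbert_space bop set \<Rightarrow> ('a bop \<Rightarrow> 'b::chilbert_space bop) \<Rightarrow> bool" where
  "faithful_representation_on \<A> \<pi> \<longleftrightarrow> representation_on \<A> \<pi> \<and> inj_on \<pi> \<A>"

text \<open>For a unital algebra, nondegenerate means unital.\<close>

lemma representation_on_unit:
  assumes "representation_on \<A> \<pi>" and e: "e \<in> \<A>" "\<And>a. a \<in> \<A> \<Longrightarrow> e * a = a"
  shows "\<pi> e = 1"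
proof (rule bop_eqI)
  let ?S = "{x. \<pi> e \<cdot> x = x}"
  have "\<pi> e \<cdot> \<pi> a \<cdot> x = \<pi> a \<cdot> x" if "a \<in> \<A>" for a x
  proof -
    have "\<pi> e * \<pi> a = \<pi> a"
      using assms(1) e that unfolding representation_on_def by metis
    then show ?thesis
      by (simp flip: bop_apply_simps(7))
  qed
  then have "{\<pi> a \<cdot> x | a x. a \<in> \<A>} \<subseteq> ?S"
    by auto
  moreover have "subspace ?S"
    by (simp add: subspace_def linear_simps[OF bounded_linear_bop_apply])
  ultimately have "span {\<pi> a \<cdot> x | a x. a \<in> \<A>} \<subseteq> ?S"
    by (rule span_minimal)
  moreover have "closed ?S"
    by (intro closed_Collect_eq continuous_on_id
        linear_continuous_on bounded_linear_bop_apply)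
  ultimately have "closure (span {\<pi> a \<cdot> x | a x. a \<in> \<A>}) \<subseteq> ?S"
    by (rule closure_minimal)
  then show "\<pi> e \<cdot> x = 1 \<cdot> x" for x
    using assms(1) unfolding representation_on_def by auto
qed


section \<open>Unital completely positive maps and hyperrigidity\<close>

text \<open>An \<open>n \<times> n\<close> matrix \<open>M\<close> over \<open>B(L)\<close> acts on \<open>L\<^sup>n\<close> by \<open>(M x)\<^sub>i = \<Sum>\<^sub>j M\<^sub>i\<^sub>j x\<^sub>j\<close>;
  positivity of this operator means \<open>\<langle>M x, x\<rangle> \<ge> 0\<close> for all \<open>x \<in> L\<^sup>n\<close>.\<close>

definition positive_matrix :: "nat \<Rightarrow> (nat \<Rightarrow> nat \<Rightarrow> 'a::chilbert_space bop) \<Rightarrow> bool" where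
  "positive_matrix n M \<longleftrightarrow>
     (\<forall>x :: nat \<Rightarrow> 'a. (\<Sum>i<n. cinner (\<Sum>j<n. M i j \<cdot> x j) (x i)) \<in> \<real>\<^sub>\<ge>\<^sub>0)"

definition completely_positive ::
    "('a::chilbert_space bop \<Rightarrow> 'b::chilbert_space bop) \<Rightarrow> bool" where
  "completely_positive \<phi> \<longleftrightarrow> clinear \<phi> \<and>
     (\<forall>n M. positive_matrix n M \<longrightarrow> positive_matrix n (\<lambda>i j. \<phi> (M i j)))"

definition UCP :: "('a::chilbert_space bop \<Rightarrow> 'b::chilbert_space bop) \<Rightarrow> bool" where
  "UCP \<phi> \<longleftrightarrow> completely_positive \<phi> \<and> \<phi> 1 = 1"

text \<open>The type argument is the Hilbert space \<open>L\<close> that carries the representations. HOL cannot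
  quantify over types inside a formula, so hyperrigidity proper is
  \<open>hyperrigid_generator TYPE('l) \<A> \<G>\<close> for an arbitrary type variable \<open>'l\<close>.\<close>

definition hyperrigid_generator ::
    "'l::chilbert_space itself \<Rightarrow> 'h::chilbert_space bop set \<Rightarrow> 'h bop set \<Rightarrow> bool" where
  "hyperrigid_generator _ \<A> \<G> \<longleftrightarrow> countable \<G> \<and> cstar_generated \<G> = \<A> \<and>
     (\<forall>(\<pi> :: 'h bop \<Rightarrow> 'l bop) (\<phi> :: nat \<Rightarrow> 'l bop \<Rightarrow> 'l bop).
        faithful_representation_on \<A> \<pi> \<longrightarrow> (\<forall>n. UCP (\<phi> n)) \<longrightarrow>
        (\<forall>g\<in>\<G>. (\<lambda>n. norm (\<phi> n (\<pi> g) - \<pi> g)) \<longlonglongrightarrow> 0) \<longrightarrow>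
        (\<forall>a\<in>\<A>. (\<lambda>n. norm (\<phi> n (\<pi> a) - \<pi> a)) \<longlonglongrightarrow> 0))"

end

theory Submission
  imports Defs
begin

text \<open>
  Call \<open>a\<close> an asymptotic multiplier of \<open>\<phi>\<^sub>n\<close> if \<open>\<phi>\<^sub>n(a c) - a \<phi>\<^sub>n(c) \<longlonglongrightarrow> 0\<close> for every \<open>c\<close>. Since
  the \<open>\<phi>\<^sub>n\<close> are contractive, these operators form a norm-closed algebra, and \<open>c = 1\<close> gives
  \<open>\<phi>\<^sub>n(a) \<longlonglongrightarrow> a\<close>. So it suffices that a unitary \<open>U\<close> with \<open>\<phi>\<^sub>n(U) \<longlonglongrightarrow> U\<close> and its adjoint
  \<open>U\<^sup>*\<close> are asymptotic multipliers. With \<open>V = U\<^sup>*\<close>, the Cauchy--Schwarz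
  inequality for the Stinespring semi-inner product bounds
  \<open>\<langle>(\<phi>\<^sub>n(V\<^sup>* c) - V\<^sup>* \<phi>\<^sub>n(c)) y, x\<rangle>\<close>, the product of \<open>c \<otimes> y\<close> with \<open>V \<otimes> x - 1 \<otimes> V x\<close>, because
  the squared length of the latter vector is \<open>2 Re \<langle>(V - \<phi>\<^sub>n(V)) x, V x\<rangle>\<close>; likewise for \<open>V = U\<close>.
  Closedness is transported along the representation, which is contractive.
\<close>

section \<open>Adjoints\<close>

text \<open>For N > 0 the inequality is read off at the minimiser t = -C/N; the other signs of N are
  settled by special values of t. The lemma serves as first-order condition at a minimum (with
  \<open>B = 0\<close>) and as the engine of Cauchy--Schwarz.\<close>

lemma quadratic_nonneg_imp_discriminant:
  fixes N B C :: real
  assumes "\<And>t. 0 \<le> t\<^sup>2 * N + 2 * t * C + B"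
  shows "C\<^sup>2 \<le> N * B"
proof (cases "N = 0")
  case True
  have "C = 0"
  proof (rule ccontr)
    assume "C \<noteq> 0"
    \<comment> \<open>With N = 0 the quadratic is affine, and this t gives it the value -1.\<close>
    with assms[of "- (B + 1) / (2 * C)"] True show False
      by (simp add: field_simps)
  qed
  with True show ?thesis by simp
next
  case False
  have B: "0 \<le> B" using assms[of 0] by simp
  have "N > 0"
  proof (rule ccontr)
    assume "\<not> N > 0"
    with False have N: "N < 0" by simp
    \<comment> \<open>Chosen so that t^2 N = -(B + 1); averaging the hypothesis over t and -t
      removes the linear term.\<close>
    define t where "t = sqrt ((B + 1) / (- N))"
    have "0 \<le> t\<^sup>2 * N + B" using assms[of t] assms[of "- t"] by simp
    moreover have "t\<^sup>2 * N = - (B + 1)"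
      using N B by (simp add: t_def divide_nonneg_neg divide_nonpos_neg)
    ultimately show False by simp
  qed
  with assms[of "- C / N"] show ?thesis
    by (simp add: power2_eq_square field_simps)
qed

text \<open>Minimise \<open>\<parallel>x\<parallel>\<^sup>2 - 2 f x\<close>: minimising sequences are Cauchy by the parallelogram
  identity, and the first-order condition at the minimum is the claim.\<close>

lemma Riesz_representation:
  fixes f :: "'a::{real_inner,complete_space} \<Rightarrow> real"
  assumes f: "bounded_linear f"
  obtains y where "\<And>x. f x = inner x y"
proof -
  interpret f: bounded_linear f by fact
  define g where "g x = (norm x)\<^sup>2 - 2 * f x" for x
  obtain K where K: "\<And>x. norm (f x) \<le> norm x * K"
    using f.bounded by blast
  \<comment> \<open>Completing the square: |x|^2 - 2 K |x| = (|x| - K)^2 - K^2.\<close>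
  have "- K\<^sup>2 \<le> g x" for x
  proof -
    have "2 * f x \<le> 2 * (norm x * K)" using K[of x] by simp
    moreover have "0 \<le> (norm x - K)\<^sup>2" by simp
    ultimately show ?thesis unfolding g_def by (simp add: power2_diff)
  qed
  then have bdd: "bdd_below (range g)" by (intro bdd_belowI2)
  define m where "m = Inf (range g)"
  have m: "m \<le> g x" for x
    unfolding m_def using bdd by (intro cInf_lower) auto
  have "\<exists>x. g x < m + 1 / real (Suc n)" for n
  proof -
    have "\<exists>z\<in>range g. z < m + 1 / real (Suc n)"
      unfolding m_def by (intro cInf_lessD) auto
    then show ?thesis by blast
  qed
  then obtain X where X: "\<And>n. g (X n) < m + 1 / real (Suc n)" by metis
  have par: "(norm (x - y))\<^sup>2 \<le> 2 * (g x + g y - 2 * m)" for x y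
  proof -
    \<comment> \<open>The midpoint competes for the infimum \<open>m\<close>, so x and y are close
      once g x and g y are close to \<open>m\<close>.\<close>
    have "g x + g y = 2 * g ((1/2) *\<^sub>R (x + y)) + (norm (x - y))\<^sup>2 / 2"
      unfolding g_def
      by (simp add: f.scaleR f.add power_mult_distrib power2_norm_eq_inner
          inner_add_left inner_add_right inner_diff_left inner_diff_right inner_commute field_simps)
    with m[of "(1/2) *\<^sub>R (x + y)"] show ?thesis by simp
  qed
  have "Cauchy X"
  proof (rule metric_CauchyI)
    fix e :: real assume e: "e > 0"
    \<comment> \<open>Two tolerances e^2/4, doubled in \<open>par\<close>, add up to e^2.\<close>
    obtain N where N: "1 / real (Suc N) < e\<^sup>2 / 4"
      using reals_Archimedean[of "e\<^sup>2 / 4"] e by (auto simp: inverse_eq_divide)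
    have gX: "g (X k) < m + e\<^sup>2 / 4" if "k \<ge> N" for k
    proof -
      have "1 / real (Suc k) \<le> 1 / real (Suc N)" using that by (simp add: frac_le)
      also note N
      finally show ?thesis by (rule order.strict_trans[OF X add_strict_left_mono])
    qed
    have "dist (X i) (X j) < e" if "i \<ge> N" "j \<ge> N" for i j
    proof -
      have "(norm (X i - X j))\<^sup>2 < e\<^sup>2"
        using par[of "X i" "X j"] gX[OF that(1)] gX[OF that(2)] by (simp add: field_simps)
      then show ?thesis using e by (simp add: dist_norm power2_less_imp_less)
    qed
    then show "\<exists>M. \<forall>i\<ge>M. \<forall>j\<ge>M. dist (X i) (X j) < e" by blast
  qed
  then obtain y where y: "X \<longlonglongrightarrow> y" by (auto simp: Cauchy_convergent_iff convergent_def)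
  have "(\<lambda>n. g (X n)) \<longlonglongrightarrow> g y"
    unfolding g_def by (intro tendsto_intros y f.tendsto)
  moreover have "(\<lambda>n. m + 1 / real (Suc n)) \<longlonglongrightarrow> m + 0"
    by (intro tendsto_intros LIMSEQ_Suc[OF lim_1_over_n])
  ultimately have "g y \<le> m + 0"
    by (rule LIMSEQ_le) (use X less_imp_le in blast)
  then have gy: "g y \<le> m" by simp
  have "f v = inner v y" for v
  proof -
    \<comment> \<open>The variation of \<open>g\<close> at its minimiser y in direction v; as the
      constant term is 0, the discriminant bound makes the linear coefficient vanish.\<close>
    have "0 \<le> t\<^sup>2 * (norm v)\<^sup>2 + 2 * t * (inner v y - f v) + 0" for t
    proof -
      have "g (y + t *\<^sub>R v) = g y + t\<^sup>2 * (norm v)\<^sup>2 + 2 * t * (inner v y - f v)"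
        unfolding g_def power2_norm_eq_inner f.add f.scaleR
        by (simp add: inner_add_left inner_add_right inner_commute algebra_simps power2_eq_square)
      then show ?thesis using gy m[of "y + t *\<^sub>R v"] by simp
    qed
    from quadratic_nonneg_imp_discriminant[OF this] show ?thesis by simp
  qed
  with that show ?thesis by blast
qed

section \<open>Calculus of the complex inner product and of adjoints\<close>

lemma cinner_scaleC_right: "cinner x (c *\<^sub>C y) = cnj c * cinner x y"
  by (metis cinner_commute cinner_scaleC_left complex_cnj_mult)

lemma cinner_add_right: "cinner x (y + z) = cinner x y + cinner x z"
  by (metis cinner_commute cinner_add_left complex_cnj_add)

text \<open>Since cnj \<i> = -\<i>, rotating y exchanges real and imaginary parts; this lifts
  identities for \<open>inner\<close> to \<open>cinner\<close>.\<close>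

lemma Im_cinner: "Im (cinner x y) = inner x (\<i> *\<^sub>C y)"
  by (simp add: inner_eq_Re_cinner cinner_scaleC_right)

lemma inner_scaleC_left: "inner (c *\<^sub>C x) y = inner x (cnj c *\<^sub>C y)" for x :: "'a::complex_inner"
  by (simp add: inner_eq_Re_cinner cinner_scaleC_right cinner_scaleC_left)

lemma inner_all_eqD:
  fixes y z :: "'a::real_inner"
  assumes "\<And>x. inner x y = inner x z"
  shows "y = z"
proof -
  have "inner (y - z) (y - z) = 0" using assms[of "y - z"] by (simp add: inner_diff_right)
  then show ?thesis by simp
qed

lemmas bop_minus = linear_simps(4)[OF bounded_linear_bop_apply]
lemmas bop_scaleR = linear_simps(5)[OF bounded_linear_bop_apply]

lemma norm_bop_apply: "norm (A \<cdot> x) \<le> norm A * norm x"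
  unfolding bop_apply_def norm_bop.rep_eq by (rule norm_blinfun)

lemma norm_bop_bound:
  assumes "0 \<le> K" "\<And>x. norm (A \<cdot> x) \<le> K * norm x"
  shows "norm A \<le> K"
  using assms unfolding norm_bop_eq_onorm by (rule onorm_bound)

lemma ex_bop:
  assumes "bounded_linear f" "\<And>c x. f (c *\<^sub>C x) = c *\<^sub>C f x"
  obtains B where "\<And>x. B \<cdot> x = f x"
proof
  show "Bop (Blinfun f) \<cdot> x = f x" for x
    using assms by (simp add: bop_apply_def Bop_inverse bounded_linear_Blinfun_apply)
qed

text \<open>Riesz applied to the real functional \<open>\<lambda>x. inner (A \<cdot> x) y\<close>
  gives a vector b y for each y. Uniqueness of representing vectors makes b complex linear, and b is
  bounded because |b y|^2 = inner (A (b y)) y, where one factor |b y| cancels.\<close>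

lemma ex_adjoint:
  obtains B where "\<And>x y. cinner (A \<cdot> x) y = cinner x (B \<cdot> y)"
proof -
  have "\<exists>z. \<forall>x. inner (A \<cdot> x) y = inner x z" for y
  proof -
    have "bounded_linear (\<lambda>x. inner (A \<cdot> x) y)"
      by (intro bounded_linear_compose[OF bounded_linear_inner_left] bounded_linear_bop_apply)
    then show ?thesis by (rule Riesz_representation) metis
  qed
  then obtain b where b: "\<And>x y. inner (A \<cdot> x) y = inner x (b y)" by metis
  have scaleC: "b (c *\<^sub>C y) = c *\<^sub>C b y" for c y
    by (rule inner_all_eqD)
      (metis b bop_apply_scaleC complex_cnj_cnj inner_scaleC_left)
  have "bounded_linear b"
  proof (rule bounded_linear_intro)
    show "b (x + y) = b x + b y" for x y
      by (rule inner_all_eqD) (simp add: inner_add_right flip: b)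
    show "b (r *\<^sub>R x) = r *\<^sub>R b x" for r x
      by (rule inner_all_eqD) (simp flip: b)
    show "norm (b y) \<le> norm y * norm A" for y
    proof -
      have "norm (b y) * norm (b y) = inner (A \<cdot> b y) y"
        by (simp add: b flip: power2_norm_eq_inner power2_eq_square)
      also have "\<dots> \<le> norm (A \<cdot> b y) * norm y" by (rule norm_cauchy_schwarz)
      also have "\<dots> \<le> norm A * norm (b y) * norm y"
        by (intro mult_right_mono norm_bop_apply) auto
      finally have "norm (b y) * norm (b y) \<le> norm (b y) * (norm y * norm A)"
        by (simp add: algebra_simps)
      then show ?thesis by (cases "norm (b y) = 0") (simp_all add: mult_le_cancel_left)
    qed
  qed
  then obtain B where B: "\<And>x. B \<cdot> x = b x" using ex_bop scaleC by metis
  have "cinner (A \<cdot> x) y = cinner x (B \<cdot> y)" for x y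
    by (rule complex_eqI)
      (simp_all add: Im_cinner b B scaleC flip: inner_eq_Re_cinner)
  with that show ?thesis by blast
qed

lemma adj_eqI:
  assumes "\<And>x y. cinner (A \<cdot> x) y = cinner x (B \<cdot> y)"
  shows "adj A = B"
  unfolding adj_def
proof (rule the_equality)
  fix C assume "\<forall>x y. cinner (A \<cdot> x) y = cinner x (C \<cdot> y)"
  with assms have "inner x (C \<cdot> y) = inner x (B \<cdot> y)" for x y
    by (simp add: inner_eq_Re_cinner)
  then show "C = B" by (intro bop_eqI) (rule inner_all_eqD)
qed (use assms in blast)

lemma cinner_adj: "cinner (A \<cdot> x) y = cinner x (adj A \<cdot> y)"
  by (metis ex_adjoint adj_eqI)

lemma cinner_adj': "cinner (adj A \<cdot> x) y = cinner x (A \<cdot> y)"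
  by (metis cinner_adj cinner_commute)

lemma inner_adj: "inner (A \<cdot> x) y = inner x (adj A \<cdot> y)"
  by (simp add: inner_eq_Re_cinner cinner_adj)

lemma inner_adj': "inner (adj A \<cdot> x) y = inner x (A \<cdot> y)"
  by (simp add: inner_eq_Re_cinner cinner_adj')

lemma adj_adj [simp]: "adj (adj A) = A"
  by (rule adj_eqI) (rule cinner_adj')

lemma adj_add: "adj (A + B) = adj A + adj B"
  by (rule adj_eqI) (simp add: cinner_adj cinner_add_left cinner_add_right)

lemma adj_mult: "adj (A * B) = adj B * adj A"
  by (rule adj_eqI) (simp add: cinner_adj)

lemma adj_scaleC: "adj (c *\<^sub>C A) = cnj c *\<^sub>C adj A"
  by (rule adj_eqI) (simp add: cinner_adj cinner_scaleC_left cinner_scaleC_right)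

lemma adj_zero [simp]: "adj 0 = 0"
  using adj_add[of 0 0] by simp

lemma adj_one [simp]: "adj 1 = 1"
  by (rule adj_eqI) simp

lemma norm_adj_le: "norm (adj A) \<le> norm A"
proof (rule norm_bop_bound)
  fix y
  let ?z = "adj A \<cdot> y"
  have "norm ?z * norm ?z = inner (A \<cdot> ?z) y"
    by (simp only: inner_adj[of A] power2_norm_eq_inner power2_eq_square[symmetric])
  also have "\<dots> \<le> norm (A \<cdot> ?z) * norm y" by (rule norm_cauchy_schwarz)
  also have "\<dots> \<le> norm A * norm ?z * norm y"
    by (intro mult_right_mono norm_bop_apply) auto
  finally have "norm ?z * norm ?z \<le> norm ?z * (norm A * norm y)"
    by (simp add: algebra_simps)
  then show "norm ?z \<le> norm A * norm y"
    by (cases "norm ?z = 0") (simp_all add: mult_le_cancel_left)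
qed simp

lemma norm_adj [simp]: "norm (adj A) = norm A"
  by (metis norm_adj_le adj_adj order_antisym)

text \<open>Conjugate linearity is linearity over the reals, which is what
  \<open>bounded_linear\<close> asks; the lemma provides continuity of the adjoint.\<close>

lemma bounded_linear_adj: "bounded_linear adj"
proof (rule bounded_linear_intro)
  show "adj (r *\<^sub>R A) = r *\<^sub>R adj A" for r A
    using adj_scaleC[of "complex_of_real r" A] by (simp add: scaleC_of_real)
  show "norm (adj A) \<le> norm A * 1" for A by simp
qed (rule adj_add)


section \<open>Representations are contractive\<close>

instance chilbert_space \<subseteq> banach ..

text \<open>The embedding into the bounded real-linear maps is isometric and that space is complete;
  complex homogeneity survives pointwise limits.\<close>

instance bop :: (chilbert_space) banach
proof
  fix X :: "nat \<Rightarrow> 'a bop" assume X: "Cauchy X"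
  have "dist (blinfun_of_bop A) (blinfun_of_bop B) = dist A B" for A B :: "'a bop"
    by (simp add: dist_norm norm_bop.rep_eq minus_bop.rep_eq)
  with X have "Cauchy (\<lambda>n. blinfun_of_bop (X n))" by (simp add: Cauchy_def)
  then obtain B where B: "(\<lambda>n. blinfun_of_bop (X n)) \<longlonglongrightarrow> B"
    by (auto simp: Cauchy_convergent_iff convergent_def)
  then have lim: "(\<lambda>n. X n \<cdot> x) \<longlonglongrightarrow> blinfun_apply B x" for x
    unfolding bop_apply_def by (intro tendsto_intros)
  have "blinfun_apply B (c *\<^sub>C x) = c *\<^sub>C blinfun_apply B x" for c x
  proof (rule LIMSEQ_unique)
    show "(\<lambda>n. X n \<cdot> (c *\<^sub>C x)) \<longlonglongrightarrow> blinfun_apply B (c *\<^sub>C x)" by (rule lim)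
    show "(\<lambda>n. X n \<cdot> (c *\<^sub>C x)) \<longlonglongrightarrow> c *\<^sub>C blinfun_apply B x"
      unfolding bop_apply_scaleC
      by (intro bounded_linear.tendsto[OF bounded_linear_scaleC] lim)
  qed
  then have "blinfun_of_bop (Bop B) = B" by (simp add: Bop_inverse)
  with B have "(\<lambda>n. dist (X n) (Bop B)) \<longlonglongrightarrow> 0"
    by (simp add: tendsto_dist_iff[of _ B] dist_norm norm_bop.rep_eq minus_bop.rep_eq)
  then have "X \<longlonglongrightarrow> Bop B" by (simp flip: tendsto_dist_iff)
  then show "convergent X" by (auto simp: convergent_def)
qed

text \<open>Only an inequality, since on the zero space the identity has norm 0.\<close>

lemma norm_bop_one_le: "norm (1 :: 'a::chilbert_space bop) \<le> 1"
  by (rule norm_bop_bound) auto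

lemma norm_bop_power_le: "norm (a ^ n) \<le> norm (a :: 'a::chilbert_space bop) ^ n"
proof (induction n)
  case (Suc n)
  have "norm (a * a ^ n) \<le> norm a * norm (a ^ n)" by (rule norm_mult_ineq)
  also have "\<dots> \<le> norm a * norm a ^ n" using Suc by (intro mult_left_mono) auto
  finally show ?case by simp
qed (simp add: norm_bop_one_le)

section \<open>C*-subalgebras and Neumann series\<close>

lemma
  assumes "cstar_subalgebra \<A>"
  shows cstar_subalgebra_zero: "0 \<in> \<A>"
    and cstar_subalgebra_add: "a \<in> \<A> \<Longrightarrow> b \<in> \<A> \<Longrightarrow> a + b \<in> \<A>"
    and cstar_subalgebra_mult: "a \<in> \<A> \<Longrightarrow> b \<in> \<A> \<Longrightarrow> a * b \<in> \<A>"
    and cstar_subalgebra_scaleC: "a \<in> \<A> \<Longrightarrow> c *\<^sub>C a \<in> \<A>"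
    and cstar_subalgebra_adj: "a \<in> \<A> \<Longrightarrow> adj a \<in> \<A>"
    and cstar_subalgebra_closed: "closed \<A>"
  using assms by (auto simp: cstar_subalgebra_def)

lemma cstar_subalgebra_scaleR:
  "cstar_subalgebra \<A> \<Longrightarrow> a \<in> \<A> \<Longrightarrow> r *\<^sub>R a \<in> \<A>"
  by (metis cstar_subalgebra_scaleC scaleC_of_real)

lemma cstar_subalgebra_diff:
  assumes "cstar_subalgebra \<A>" "a \<in> \<A>" "b \<in> \<A>"
  shows "a - b \<in> \<A>"
  using cstar_subalgebra_add[OF assms(1,2) cstar_subalgebra_scaleR[OF assms(1,3), of "-1"]]
  by simp

text \<open>The geometric series converges in norm and its partial sums lie in \<open>\<A>\<close>,
  so closedness keeps the inverse in \<open>\<A>\<close>, where a representation can be applied to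
  it.\<close>

lemma Neumann_series_in_subalgebra:
  assumes A: "cstar_subalgebra \<A>" "1 \<in> \<A>" and a: "a \<in> \<A>" "norm a < 1"
  obtains b where "b \<in> \<A>" "b * (1 - a) = 1"
proof -
  have "summable (\<lambda>n. norm (a ^ n))"
    by (rule summable_comparison_test'[where g = "\<lambda>n. norm a ^ n" and N = 0])
      (use a in \<open>simp_all add: norm_bop_power_le\<close>)
  then have s: "summable (\<lambda>n. a ^ n)" by (rule summable_norm_cancel)
  have pow: "a ^ n \<in> \<A>" for n
    by (induction n) (auto intro: A a cstar_subalgebra_mult)
  have part: "(\<Sum>k<n. a ^ k) \<in> \<A>" for n
    by (induction n) (auto intro: A pow cstar_subalgebra_zero cstar_subalgebra_add)
  have lim: "(\<lambda>n. \<Sum>k<n. a ^ k) \<longlonglongrightarrow> suminf (\<lambda>n. a ^ n)"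
    using s by (rule summable_LIMSEQ)
  have tele: "(\<Sum>k<n. a ^ k) * (1 - a) = 1 - a ^ n" for n
  proof (induction n)
    case (Suc n)
    have "(\<Sum>k<Suc n. a ^ k) * (1 - a) = (\<Sum>k<n. a ^ k) * (1 - a) + a ^ n * (1 - a)"
      by (simp add: distrib_right)
    then show ?case
      unfolding Suc by (simp add: right_diff_distrib power_Suc2 del: power_Suc)
  qed simp
  have "(\<lambda>n. (\<Sum>k<n. a ^ k) * (1 - a)) \<longlonglongrightarrow> suminf (\<lambda>n. a ^ n) * (1 - a)"
    by (intro tendsto_intros lim)
  moreover have "(\<lambda>n. 1 - a ^ n) \<longlonglongrightarrow> 1 - 0"
    by (intro tendsto_intros summable_LIMSEQ_zero s)
  ultimately have "suminf (\<lambda>n. a ^ n) * (1 - a) = 1"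
    unfolding tele using LIMSEQ_unique by fastforce
  moreover have "suminf (\<lambda>n. a ^ n) \<in> \<A>"
    using closed_sequentially[OF cstar_subalgebra_closed[OF A(1)] _ lim] part by blast
  ultimately show ?thesis using that by blast
qed

lemma norm_scaleR_diff_square:
  "(norm (c *\<^sub>R x - y))\<^sup>2 = c\<^sup>2 * (norm x)\<^sup>2 - 2 * c * inner x y + (norm y)\<^sup>2"
  for x y :: "'a::real_inner"
  unfolding power2_norm_eq_inner
  by (simp add: inner_diff_left inner_diff_right inner_commute algebra_simps power2_eq_square)

text \<open>For \<open>c = \<parallel>b\<parallel>\<^sup>2\<close> the operator \<open>c - b\<^sup>* b\<close> is not bounded below on unit vectors,
  hence not left invertible.\<close>

lemma not_left_invertible_norm_minus_adj_mult:
  assumes "b \<noteq> 0"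
  shows "d * ((norm b)\<^sup>2 *\<^sub>R 1 - adj b * b) \<noteq> 1"
proof
  let ?c = "(norm b)\<^sup>2"
  assume d: "d * (?c *\<^sub>R 1 - adj b * b) = 1"
  let ?D = "2 * (norm d)\<^sup>2 * ?c"
  \<comment> \<open>Left invertibility bounds |x| by |d| |c x - b* b x| with c = |b|^2. Expanding
    the square and using |b* b x| \<le> c |x| produces the constant \<open>?D\<close>.\<close>
  have est: "(norm x)\<^sup>2 \<le> ?D * (?c * (norm x)\<^sup>2 - (norm (b \<cdot> x))\<^sup>2)" for x
  proof -
    let ?y = "adj b \<cdot> b \<cdot> x"
    have ny: "norm ?y \<le> norm b * (norm b * norm x)"
      using norm_bop_apply[of "adj b" "b \<cdot> x"] norm_bop_apply[of b x]
      by (smt (verit) mult_left_mono norm_adj norm_ge_zero)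
    have "inner x ?y = (norm (b \<cdot> x))\<^sup>2"
      by (simp add: power2_norm_eq_inner inner_adj)
    then have "(norm (?c *\<^sub>R x - ?y))\<^sup>2 = ?c\<^sup>2 * (norm x)\<^sup>2 - 2 * ?c * (norm (b \<cdot> x))\<^sup>2 + (norm ?y)\<^sup>2"
      by (simp add: norm_scaleR_diff_square)
    also have "(norm ?y)\<^sup>2 \<le> ?c\<^sup>2 * (norm x)\<^sup>2"
      using power_mono[OF ny, of 2] by (simp add: power2_eq_square algebra_simps)
    finally have 1: "(norm (?c *\<^sub>R x - ?y))\<^sup>2 \<le> 2 * ?c * (?c * (norm x)\<^sup>2 - (norm (b \<cdot> x))\<^sup>2)"
      by (simp add: algebra_simps power2_eq_square)
    have "x = d \<cdot> (?c *\<^sub>R x - ?y)"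
      using arg_cong[OF d, of "\<lambda>A. A \<cdot> x"] by simp
    then have "norm x \<le> norm d * norm (?c *\<^sub>R x - ?y)" by (metis norm_bop_apply)
    then have "(norm x)\<^sup>2 \<le> (norm d)\<^sup>2 * (norm (?c *\<^sub>R x - ?y))\<^sup>2"
      by (metis norm_ge_zero power_mono power_mult_distrib)
    also have "\<dots> \<le> (norm d)\<^sup>2 * (2 * ?c * (?c * (norm x)\<^sup>2 - (norm (b \<cdot> x))\<^sup>2))"
      by (intro mult_left_mono 1) auto
    finally show ?thesis by (simp add: algebra_simps)
  qed
  have c: "?c > 0" using assms by simp
  \<comment> \<open>Secures \<open>?D > 0\<close> for the division below: d = 0 would give 0 = 1 and
    hence b = 0.\<close>
  have "d \<noteq> 0"
  proof
    assume "d = 0"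
    with d have "(0 :: 'a bop) = 1" by simp
    then have "b = 0" by (metis mult_zero_right mult_1_right)
    with assms show False by blast
  qed
  with c have D: "?D > 0" by simp
  \<comment> \<open>Rearranging \<open>est\<close> gives |b x|^2 \<le> (c - 1/D) |x|^2, so K bounds
    b although K < |b|. Truncation at 0 keeps K nonnegative.\<close>
  define K where "K = sqrt (max 0 (?c - 1 / ?D))"
  have "norm (b \<cdot> x) \<le> K * norm x" for x
  proof -
    have "(norm (b \<cdot> x))\<^sup>2 \<le> (?c - 1 / ?D) * (norm x)\<^sup>2"
    proof -
      have "(norm x)\<^sup>2 / ?D \<le> ?c * (norm x)\<^sup>2 - (norm (b \<cdot> x))\<^sup>2"
        using est[of x] D by (simp only: pos_divide_le_eq mult.commute)
      then show ?thesis by (simp add: algebra_simps)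
    qed
    also have "\<dots> \<le> (K * norm x)\<^sup>2"
      by (simp add: K_def power_mult_distrib mult_right_mono)
    finally show ?thesis
      by (rule power2_le_imp_le) (simp add: K_def)
  qed
  then have "norm b \<le> K" by (intro norm_bop_bound) (simp_all add: K_def)
  then have "?c \<le> K\<^sup>2" by (intro power_mono) auto
  moreover have "K\<^sup>2 < ?c" using c D by (simp add: K_def max_def)
  ultimately show False by simp
qed

lemma
  assumes "representation_on \<A> \<pi>"
  shows representation_on_add: "a \<in> \<A> \<Longrightarrow> b \<in> \<A> \<Longrightarrow> \<pi> (a + b) = \<pi> a + \<pi> b"
    and representation_on_mult: "a \<in> \<A> \<Longrightarrow> b \<in> \<A> \<Longrightarrow> \<pi> (a * b) = \<pi> a * \<pi> b"
    and representation_on_scaleC: "a \<in> \<A> \<Longrightarrow> \<pi> (c *\<^sub>C a) = c *\<^sub>C \<pi> a"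
    and representation_on_adj: "a \<in> \<A> \<Longrightarrow> \<pi> (adj a) = adj (\<pi> a)"
  using assms by (auto simp: representation_on_def)

lemma representation_on_scaleR:
  "representation_on \<A> \<pi> \<Longrightarrow> a \<in> \<A> \<Longrightarrow> \<pi> (r *\<^sub>R a) = r *\<^sub>R \<pi> a"
  by (metis representation_on_scaleC scaleC_of_real)

lemma representation_on_diff:
  assumes "representation_on \<A> \<pi>" "cstar_subalgebra \<A>" "a \<in> \<A>" "b \<in> \<A>"
  shows "\<pi> (a - b) = \<pi> a - \<pi> b"
  using representation_on_add[OF assms(1) cstar_subalgebra_diff[OF assms(2-4)] assms(4)] by simp

text \<open>If |a| < |\<pi> a|, put c = |\<pi> a|^2. Then a* a / c has norm below 1, so 1 - a* a / c
  has a left inverse in \<open>\<A>\<close>. Its image under \<pi> would make c - (\<pi> a)* (\<pi>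
  a) left invertible, which is impossible.\<close>

lemma norm_representation_on_le:
  assumes \<pi>: "representation_on \<A> \<pi>" and A: "cstar_subalgebra \<A>" "1 \<in> \<A>" and a: "a \<in> \<A>"
  shows "norm (\<pi> a) \<le> norm a"
proof (rule ccontr)
  assume "\<not> ?thesis"
  then have less: "norm a < norm (\<pi> a)" by simp
  then have b0: "\<pi> a \<noteq> 0" by auto
  let ?c = "(norm (\<pi> a))\<^sup>2"
  have c: "?c > 0" using b0 by simp
  have one: "\<pi> 1 = 1" using representation_on_unit[OF \<pi> A(2)] by simp
  have aa: "adj a * a \<in> \<A>" using A a by (intro cstar_subalgebra_mult cstar_subalgebra_adj)
  let ?h = "inverse ?c *\<^sub>R (adj a * a)"
  have h: "?h \<in> \<A>" using A aa by (intro cstar_subalgebra_scaleR)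
  have "norm (adj a * a) \<le> (norm a)\<^sup>2"
    using norm_mult_ineq[of "adj a" a] by (simp add: power2_eq_square)
  also have "\<dots> < ?c" using less by (intro power_strict_mono) auto
  finally have "norm (adj a * a) / ?c < 1" using c by (simp only: divide_less_eq_1_pos)
  then have "norm ?h < 1" by (simp add: divide_inverse mult.commute)
  from Neumann_series_in_subalgebra[OF A h this]
  obtain d where d: "d \<in> \<A>" "d * (1 - ?h) = 1" by blast
  have "\<pi> d * (1 - inverse ?c *\<^sub>R (adj (\<pi> a) * \<pi> a)) = \<pi> (d * (1 - ?h))"
    by (simp only: representation_on_mult[OF \<pi> d(1) cstar_subalgebra_diff[OF A h]]
        representation_on_diff[OF \<pi> A h] representation_on_scaleR[OF \<pi> aa]
        representation_on_mult[OF \<pi> cstar_subalgebra_adj[OF A(1) a] a]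
        representation_on_adj[OF \<pi> a] one)
  then have inv: "\<pi> d * (1 - inverse ?c *\<^sub>R (adj (\<pi> a) * \<pi> a)) = 1"
    by (simp only: d(2) one)
  have "1 - inverse ?c *\<^sub>R (adj (\<pi> a) * \<pi> a)
      = inverse ?c *\<^sub>R (?c *\<^sub>R 1 - adj (\<pi> a) * \<pi> a)"
    using c by (simp add: scaleR_diff_right)
  with inv have "(inverse ?c *\<^sub>R \<pi> d) * (?c *\<^sub>R 1 - adj (\<pi> a) * \<pi> a) = 1"
    by (simp only: mult_scaleR_left mult_scaleR_right)
  with not_left_invertible_norm_minus_adj_mult[OF b0] show False by blast
qed


section \<open>Unital completely positive maps\<close>

text \<open>Cancels one factor |x|^2 after Cauchy--Schwarz has been tested against the very vector
  to be estimated.\<close>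

lemma norm_le_if_inner_square_le:
  fixes x :: "'a::real_inner"
  assumes le: "(inner x x)\<^sup>2 \<le> (norm x)\<^sup>2 * K\<^sup>2" and K: "0 \<le> K"
  shows "norm x \<le> K"
proof (cases "x = 0")
  case False
  have "(norm x)\<^sup>2 * (norm x)\<^sup>2 \<le> (norm x)\<^sup>2 * K\<^sup>2"
    using le by (simp only: power2_norm_eq_inner power2_eq_square[of "inner x x"])
  then have "(norm x)\<^sup>2 \<le> K\<^sup>2" by (rule mult_left_le_imp_le) (use False in simp)
  with K show ?thesis by (rule power2_le_imp_le[rotated])
qed (use K in simp)

lemma cinner_sum_left: "cinner (\<Sum>i\<in>I. f i) y = (\<Sum>i\<in>I. cinner (f i) y)"
proof (induction I rule: infinite_finite_induct)
  case (insert i I)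
  then show ?case by (simp add: cinner_add_left)
qed (use cinner_add_left[of 0 0 y] in auto)

lemma cinner_sum_right: "cinner x (\<Sum>i\<in>I. f i) = (\<Sum>i\<in>I. cinner x (f i))"
proof (induction I rule: infinite_finite_induct)
  case (insert i I)
  then show ?case by (simp add: cinner_add_right)
qed (use cinner_add_right[of x 0 0] in auto)

lemma cinner_self: "cinner x x = complex_of_real ((norm x)\<^sup>2)"
proof (rule complex_eqI)
  show "Re (cinner x x) = Re (complex_of_real ((norm x)\<^sup>2))"
    by (simp add: power2_norm_eq_inner inner_eq_Re_cinner)
  have "Im (cinner x x) = - Im (cinner x x)"
    using arg_cong[OF cinner_commute[of x x], of Im] by (simp only: complex_cnj cnj.sel)
  then show "Im (cinner x x) = Im (complex_of_real ((norm x)\<^sup>2))" by simp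
qed

text \<open>The quadratic form is the squared norm of the sum of the vectors
  \<open>a j \<cdot> x j\<close>.\<close>

lemma positive_matrix_Gram: "positive_matrix n (\<lambda>i j. adj (a i) * a j)"
  unfolding positive_matrix_def
proof
  fix x :: "nat \<Rightarrow> 'a"
  have "(\<Sum>i<n. cinner (\<Sum>j<n. (adj (a i) * a j) \<cdot> x j) (x i))
      = cinner (\<Sum>j<n. a j \<cdot> x j) (\<Sum>i<n. a i \<cdot> x i)"
    by (simp add: cinner_sum_left cinner_sum_right cinner_adj')
  also have "\<dots> \<in> \<real>\<^sub>\<ge>\<^sub>0" by (simp add: cinner_self complex_nonneg_Reals_iff)
  finally show "(\<Sum>i<n. cinner (\<Sum>j<n. (adj (a i) * a j) \<cdot> x j) (x i)) \<in> \<real>\<^sub>\<ge>\<^sub>0" .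
qed

context
  fixes \<phi> :: "'a::chilbert_space bop \<Rightarrow> 'b::chilbert_space bop"
  assumes ucp: "UCP \<phi>"
begin

lemma UCP_one: "\<phi> 1 = 1"
  using ucp by (simp add: UCP_def)

lemma UCP_add: "\<phi> (a + b) = \<phi> a + \<phi> b"
  using ucp by (simp add: UCP_def completely_positive_def clinear_def)

lemma UCP_scaleC: "\<phi> (c *\<^sub>C a) = c *\<^sub>C \<phi> a"
  using ucp by (simp add: UCP_def completely_positive_def clinear_def)

lemma UCP_scaleR: "\<phi> (r *\<^sub>R a) = r *\<^sub>R \<phi> a"
  using UCP_scaleC[of "complex_of_real r" a] by (simp add: scaleC_of_real)

lemma UCP_diff: "\<phi> (a - b) = \<phi> a - \<phi> b"
  using UCP_add[of "a - b" b] by simp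

lemma UCP_positive_matrix: "positive_matrix n M \<Longrightarrow> positive_matrix n (\<lambda>i j. \<phi> (M i j))"
  using ucp by (simp add: UCP_def completely_positive_def)

text \<open>Positivity of the Stinespring semi-inner product: the sum is the squared length of the
  sum of the tensors \<open>a j\<close> \<otimes> \<open>x j\<close>.\<close>

lemma UCP_Gram_nonneg:
  "(\<Sum>i<n. cinner (\<Sum>j<n. \<phi> (adj (a i) * a j) \<cdot> x j) (x i)) \<in> \<real>\<^sub>\<ge>\<^sub>0" for n :: nat
  using UCP_positive_matrix[OF positive_matrix_Gram[of n a]] unfolding positive_matrix_def by blast

lemma UCP_adj_mult_nonneg: "cinner (\<phi> (adj b * b) \<cdot> x) x \<in> \<real>\<^sub>\<ge>\<^sub>0"
  using UCP_Gram_nonneg[where n = 1 and a = "\<lambda>_. b" and x = "\<lambda>_. x"] by simp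

text \<open>The form of the Gram matrix of 1 and a is real, and so are its diagonal terms; hence the
  imaginary parts of the off-diagonal terms cancel. Replacing x by \<i> x yields the same for the
  real parts.\<close>

lemma UCP_adj: "\<phi> (adj a) = adj (\<phi> a)"
proof -
  have Im: "Im (cinner (\<phi> a \<cdot> y) x) = - Im (cinner (\<phi> (adj a) \<cdot> x) y)" for x y
  proof -
    have "cinner x x + cinner (\<phi> a \<cdot> y) x + (cinner (\<phi> (adj a) \<cdot> x) y + cinner (\<phi> (adj a * a) \<cdot> y) y) \<in> \<real>\<^sub>\<ge>\<^sub>0"
      using UCP_Gram_nonneg[where n = 2 and a = "\<lambda>i. if i = 0 then 1 else a" and x = "\<lambda>i. if i = 0 then x else y"]
      by (simp add: numeral_2_eq_2 UCP_one cinner_add_left)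
    moreover have "Im (cinner (\<phi> (adj a * a) \<cdot> y) y) = 0"
      using UCP_adj_mult_nonneg[of a y] by (simp add: complex_nonneg_Reals_iff)
    ultimately show ?thesis
      by (simp add: complex_nonneg_Reals_iff cinner_self)
  qed
  have "adj (\<phi> a) = \<phi> (adj a)"
  proof (rule adj_eqI)
    fix y x
    have "Im (cinner (\<phi> a \<cdot> y) x) = Im (cinner y (\<phi> (adj a) \<cdot> x))"
      using Im[of y x] by (subst cinner_commute[of y]) simp
    moreover have "Re (cinner (\<phi> a \<cdot> y) x) = Re (cinner y (\<phi> (adj a) \<cdot> x))"
      using Im[of y "\<i> *\<^sub>C x"]
      by (subst cinner_commute[of y]) (simp add: bop_apply_scaleC cinner_scaleC_left cinner_scaleC_right)
    ultimately show "cinner (\<phi> a \<cdot> y) x = cinner y (\<phi> (adj a) \<cdot> x)" by (rule complex_eqI[rotated])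
  qed
  then show ?thesis by simp
qed

text \<open>The operator |b|^2 1 - b* b is positive; apply the unital positive map \<phi> to
  it.\<close>

lemma UCP_adj_mult_le: "inner (\<phi> (adj b * b) \<cdot> x) x \<le> (norm b)\<^sup>2 * (norm x)\<^sup>2"
proof -
  have "positive_matrix 1 (\<lambda>_ _. (norm b)\<^sup>2 *\<^sub>R 1 - adj b * b)"
    unfolding positive_matrix_def
  proof
    fix x :: "nat \<Rightarrow> 'a"
    let ?y = "(norm b)\<^sup>2 *\<^sub>R x 0 - adj b \<cdot> b \<cdot> x 0"
    have "cinner (?y + adj b \<cdot> b \<cdot> x 0) (x 0) = complex_of_real ((norm b)\<^sup>2) * cinner (x 0) (x 0)"
      by (simp flip: scaleC_of_real add: cinner_scaleC_left del: of_real_power)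
    then have "cinner ?y (x 0)
        = complex_of_real ((norm b)\<^sup>2 * (norm (x 0))\<^sup>2 - (norm (b \<cdot> x 0))\<^sup>2)"
      unfolding cinner_add_left by (simp add: cinner_adj' cinner_self algebra_simps)
    moreover have "(norm (b \<cdot> x 0))\<^sup>2 \<le> (norm b)\<^sup>2 * (norm (x 0))\<^sup>2"
      using power_mono[OF norm_bop_apply[of b "x 0"], of 2] by (simp add: power_mult_distrib)
    ultimately show "(\<Sum>i<1. cinner (\<Sum>j<1. ((norm b)\<^sup>2 *\<^sub>R 1 - adj b * b) \<cdot> x j) (x i)) \<in> \<real>\<^sub>\<ge>\<^sub>0"
      by (simp add: complex_nonneg_Reals_iff)
  qed
  from UCP_positive_matrix[OF this]
  have "cinner (\<phi> ((norm b)\<^sup>2 *\<^sub>R 1 - adj b * b) \<cdot> x) x \<in> \<real>\<^sub>\<ge>\<^sub>0"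
    unfolding positive_matrix_def by (auto dest: spec[of _ "\<lambda>_. x"])
  then have "0 \<le> inner (\<phi> ((norm b)\<^sup>2 *\<^sub>R 1 - adj b * b) \<cdot> x) x"
    by (simp add: complex_nonneg_Reals_iff inner_eq_Re_cinner)
  then show ?thesis
    by (simp add: UCP_diff UCP_scaleR UCP_one inner_diff_left power2_norm_eq_inner)
qed

text \<open>Cauchy--Schwarz for the semi-inner product
  \<open>\<langle>b \<otimes> y, a \<otimes> x\<rangle> = \<langle>\<phi>(a\<^sup>* b) y, x\<rangle>\<close> of the Stinespring construction, applied to the vectors
  \<open>a \<otimes> x - 1 \<otimes> z\<close> and \<open>b \<otimes> y\<close>.\<close>

lemma UCP_Cauchy_Schwarz:
  "(inner (\<phi> (adj a * b) \<cdot> y) x - inner (\<phi> b \<cdot> y) z)\<^sup>2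
   \<le> (inner (\<phi> (adj a * a) \<cdot> x) x - 2 * inner (\<phi> a \<cdot> x) z + (norm z)\<^sup>2)
      * inner (\<phi> (adj b * b) \<cdot> y) y"
proof (rule quadratic_nonneg_imp_discriminant)
  fix t :: real
  \<comment> \<open>Indices 0, 1, 2 carry the tensors a \<otimes> t x, -(1 \<otimes> t z) and b
    \<otimes> y; the squared length of their sum is the required quadratic in t.\<close>
  let ?a = "\<lambda>i::nat. if i = 0 then a else if i = 1 then 1 else b"
  let ?x = "\<lambda>i::nat. if i = 0 then t *\<^sub>R x else if i = 1 then - (t *\<^sub>R z) else y"
  have adjs: "\<phi> (adj b * a) = adj (\<phi> (adj a * b))" "\<phi> (adj b) = adj (\<phi> b)" "\<phi> (adj a) = adj (\<phi> a)"
    by (simp_all add: adj_mult flip: UCP_adj)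
  have "0 \<le> Re (\<Sum>i<3. cinner (\<Sum>j<3. \<phi> (adj (?a i) * ?a j) \<cdot> ?x j) (?x i))"
    using UCP_Gram_nonneg[where n = 3 and a = ?a and x = ?x] by (simp add: complex_nonneg_Reals_iff)
  also have "\<dots> = (\<Sum>i<3. inner (\<Sum>j<3. \<phi> (adj (?a i) * ?a j) \<cdot> ?x j) (?x i))"
    by (simp add: inner_eq_Re_cinner)
  also have "\<dots> = t\<^sup>2 * (inner (\<phi> (adj a * a) \<cdot> x) x - 2 * inner (\<phi> a \<cdot> x) z + (norm z)\<^sup>2)
      + 2 * t * (inner (\<phi> (adj a * b) \<cdot> y) x - inner (\<phi> b \<cdot> y) z)
      + inner (\<phi> (adj b * b) \<cdot> y) y"
    by (simp add: numeral_3_eq_3 UCP_one adjs inner_add_left inner_add_right inner_diff_left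
        inner_diff_right bop_scaleR bop_minus inner_adj' power2_norm_eq_inner
        inner_commute power2_eq_square[of t] algebra_simps flip: inner_adj)
  finally show "0 \<le> \<dots>" .
qed

text \<open>Cauchy--Schwarz with a = 1, z = 0 and x = \<phi>(b) y, followed by cancellation of
  |x|^2.\<close>

lemma UCP_norm_le: "norm (\<phi> b) \<le> norm b"
proof (rule norm_bop_bound)
  fix y
  let ?x = "\<phi> b \<cdot> y"
  have "(inner ?x ?x)\<^sup>2 \<le> (norm ?x)\<^sup>2 * inner (\<phi> (adj b * b) \<cdot> y) y"
    using UCP_Cauchy_Schwarz[of 1 b y ?x 0] by (simp add: UCP_one power2_norm_eq_inner)
  also have "\<dots> \<le> (norm ?x)\<^sup>2 * ((norm b)\<^sup>2 * (norm y)\<^sup>2)"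
    by (intro mult_left_mono UCP_adj_mult_le) auto
  finally show "norm ?x \<le> norm b * norm y"
    by (intro norm_le_if_inner_square_le) (simp_all add: power_mult_distrib)
qed simp

end

text \<open>The quantitative core: an isometry V almost fixed by \<phi> makes \<open>adj V\<close>
  almost pass through \<phi>. Cauchy--Schwarz is used with a = V and z = V x, where x is the vector
  to be bounded.\<close>

lemma UCP_norm_isometry_mult_le:
  fixes \<phi> :: "'a::chilbert_space bop \<Rightarrow> 'a bop"
  assumes ucp: "UCP \<phi>" and V: "adj V * V = 1"
  shows "norm (\<phi> (adj V * b) - adj V * \<phi> b) \<le> sqrt (2 * norm (V - \<phi> V)) * norm b"
proof (rule norm_bop_bound)
  fix y
  let ?X = "\<phi> (adj V * b) - adj V * \<phi> b"
  let ?x = "?X \<cdot> y"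
  have iso: "norm (V \<cdot> x) = norm x" for x
  proof -
    have "adj V \<cdot> V \<cdot> x = x" using arg_cong[OF V, of "\<lambda>A. A \<cdot> x"] by simp
    then show ?thesis by (simp add: norm_eq_sqrt_inner inner_adj)
  qed
  have "inner ?x z = inner (\<phi> (adj V * b) \<cdot> y) z - inner (\<phi> b \<cdot> y) (V \<cdot> z)" for z
    by (simp add: inner_diff_left inner_adj')
  then have "(inner ?x ?x)\<^sup>2 \<le> (inner (\<phi> 1 \<cdot> ?x) ?x - 2 * inner (\<phi> V \<cdot> ?x) (V \<cdot> ?x) + (norm (V \<cdot> ?x))\<^sup>2)
      * inner (\<phi> (adj b * b) \<cdot> y) y"
    using UCP_Cauchy_Schwarz[OF ucp, of V b y ?x "V \<cdot> ?x"] by (simp only: V)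
  \<comment> \<open>As V is isometric and \<phi> unital, the two outer terms add up to 2 |V x|^2,
    which is twice the inner product of V x with itself.\<close>
  also have "inner (\<phi> 1 \<cdot> ?x) ?x - 2 * inner (\<phi> V \<cdot> ?x) (V \<cdot> ?x) + (norm (V \<cdot> ?x))\<^sup>2
      = 2 * inner ((V - \<phi> V) \<cdot> ?x) (V \<cdot> ?x)"
    unfolding bop_apply_simps(3)[of V "\<phi> V"] inner_diff_left
    by (simp add: UCP_one[OF ucp] iso flip: power2_norm_eq_inner del: bop_apply_simps(3))
  also have "2 * inner ((V - \<phi> V) \<cdot> ?x) (V \<cdot> ?x) * inner (\<phi> (adj b * b) \<cdot> y) y
      \<le> (2 * norm (V - \<phi> V) * (norm ?x)\<^sup>2) * ((norm b)\<^sup>2 * (norm y)\<^sup>2)"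
  proof (rule mult_mono)
    have "inner ((V - \<phi> V) \<cdot> ?x) (V \<cdot> ?x) \<le> norm ((V - \<phi> V) \<cdot> ?x) * norm (V \<cdot> ?x)"
      by (rule norm_cauchy_schwarz)
    also have "\<dots> \<le> norm (V - \<phi> V) * norm ?x * norm ?x"
      unfolding iso by (intro mult_right_mono norm_bop_apply) auto
    finally show "2 * inner ((V - \<phi> V) \<cdot> ?x) (V \<cdot> ?x) \<le> 2 * norm (V - \<phi> V) * (norm ?x)\<^sup>2"
      by (simp add: power2_eq_square algebra_simps)
    show "0 \<le> inner (\<phi> (adj b * b) \<cdot> y) y"
      using UCP_adj_mult_nonneg[OF ucp, of b y]
      by (simp add: complex_nonneg_Reals_iff inner_eq_Re_cinner)
  qed (simp_all add: UCP_adj_mult_le[OF ucp])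
  finally show "norm ?x \<le> sqrt (2 * norm (V - \<phi> V)) * norm b * norm y"
    by (intro norm_le_if_inner_square_le)
      (simp_all add: power_mult_distrib mult_ac del: bop_apply_simps)
qed simp

section \<open>Asymptotic multipliers form a closed algebra\<close>

definition asymptotic_multiplier ::
    "(nat \<Rightarrow> 'a::chilbert_space bop \<Rightarrow> 'a bop) \<Rightarrow> 'a bop \<Rightarrow> bool" where
  "asymptotic_multiplier \<phi> a \<longleftrightarrow> (\<forall>c. (\<lambda>n. \<phi> n (a * c) - a * \<phi> n c) \<longlonglongrightarrow> 0)"

context
  fixes \<phi> :: "nat \<Rightarrow> 'a::chilbert_space bop \<Rightarrow> 'a bop"
  assumes ucp: "\<And>n. UCP (\<phi> n)"
begin

lemma asymptotic_multiplier_adj_isometry: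
  assumes V: "adj V * V = 1" and lim: "(\<lambda>n. \<phi> n V) \<longlonglongrightarrow> V"
  shows "asymptotic_multiplier \<phi> (adj V)"
  unfolding asymptotic_multiplier_def
proof
  fix c :: "'a bop"
  have "(\<lambda>n. sqrt (2 * norm (V - \<phi> n V)) * norm c) \<longlonglongrightarrow> sqrt (2 * norm (V - V)) * norm c"
    by (intro tendsto_intros lim)
  then have "(\<lambda>n. sqrt (2 * norm (V - \<phi> n V)) * norm c) \<longlonglongrightarrow> 0" by simp
  then show "(\<lambda>n. \<phi> n (adj V * c) - adj V * \<phi> n c) \<longlonglongrightarrow> 0"
    by (rule Lim_null_comparison[rotated]) (simp add: UCP_norm_isometry_mult_le[OF ucp V])
qed

lemma asymptotic_multiplier_zero: "asymptotic_multiplier \<phi> 0"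
  using UCP_diff[OF ucp, where a = 0 and b = 0] by (simp add: asymptotic_multiplier_def)

lemma asymptotic_multiplier_add:
  assumes "asymptotic_multiplier \<phi> a" "asymptotic_multiplier \<phi> b"
  shows "asymptotic_multiplier \<phi> (a + b)"
  unfolding asymptotic_multiplier_def
proof
  fix c
  have "(\<lambda>n. (\<phi> n (a * c) - a * \<phi> n c) + (\<phi> n (b * c) - b * \<phi> n c)) \<longlonglongrightarrow> 0 + 0"
    using assms unfolding asymptotic_multiplier_def by (intro tendsto_add) blast+
  then show "(\<lambda>n. \<phi> n ((a + b) * c) - (a + b) * \<phi> n c) \<longlonglongrightarrow> 0"
    by (simp add: distrib_right UCP_add[OF ucp] algebra_simps)
qed

text \<open>The condition for a is used at the test operator b c, the one for b at c; this is why
  the definition tests against all operators.\<close>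

lemma asymptotic_multiplier_mult:
  assumes "asymptotic_multiplier \<phi> a" "asymptotic_multiplier \<phi> b"
  shows "asymptotic_multiplier \<phi> (a * b)"
  unfolding asymptotic_multiplier_def
proof
  fix c
  have "(\<lambda>n. (\<phi> n (a * (b * c)) - a * \<phi> n (b * c)) + a * (\<phi> n (b * c) - b * \<phi> n c)) \<longlonglongrightarrow> 0 + a * 0"
    using assms unfolding asymptotic_multiplier_def by (intro tendsto_intros) blast+
  then show "(\<lambda>n. \<phi> n ((a * b) * c) - (a * b) * \<phi> n c) \<longlonglongrightarrow> 0"
    by (simp add: algebra_simps)
qed

text \<open>Replacing l by \<open>a k\<close> costs at most |l - a k| |c| in each of two terms,
  uniformly in n because all \<open>\<phi> n\<close> are contractive. Hence k can be fixed before n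
  grows.\<close>

lemma asymptotic_multiplier_limit:
  assumes a: "\<And>k. asymptotic_multiplier \<phi> (a k)" and lim: "a \<longlonglongrightarrow> l"
  shows "asymptotic_multiplier \<phi> l"
  unfolding asymptotic_multiplier_def
proof
  fix c
  show "(\<lambda>n. \<phi> n (l * c) - l * \<phi> n c) \<longlonglongrightarrow> 0"
  proof (rule LIMSEQ_I)
    fix e :: real assume e: "e > 0"
    have "(\<lambda>k. 2 * norm (l - a k) * norm c) \<longlonglongrightarrow> 2 * norm (l - l) * norm c"
      by (intro tendsto_intros lim)
    then have "\<forall>\<^sub>F k in sequentially. 2 * norm (l - a k) * norm c < e / 2"
      using e by (intro order_tendstoD(2)) auto
    then obtain k where k: "2 * norm (l - a k) * norm c < e / 2"
      by (auto simp: eventually_sequentially)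
    from a[of k] have "(\<lambda>n. \<phi> n (a k * c) - a k * \<phi> n c) \<longlonglongrightarrow> 0"
      by (simp add: asymptotic_multiplier_def)
    from LIMSEQ_D[OF this, of "e / 2"] e obtain N
      where N: "\<And>n. n \<ge> N \<Longrightarrow> norm (\<phi> n (a k * c) - a k * \<phi> n c) < e / 2" by auto
    have "norm (\<phi> n (l * c) - l * \<phi> n c) < e" if "n \<ge> N" for n
    proof -
      have "\<phi> n (l * c) - l * \<phi> n c
          = \<phi> n ((l - a k) * c) - (l - a k) * \<phi> n c + (\<phi> n (a k * c) - a k * \<phi> n c)"
        by (simp add: algebra_simps UCP_diff[OF ucp])
      also have "norm \<dots> \<le> norm (\<phi> n ((l - a k) * c)) + norm ((l - a k) * \<phi> n c)
          + norm (\<phi> n (a k * c) - a k * \<phi> n c)"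
        by (intro order_trans[OF norm_triangle_ineq] add_right_mono norm_triangle_ineq4)
      also have "norm (\<phi> n ((l - a k) * c)) \<le> norm (l - a k) * norm c"
        by (rule order_trans[OF UCP_norm_le[OF ucp] norm_mult_ineq])
      also have "norm ((l - a k) * \<phi> n c) \<le> norm (l - a k) * norm c"
        by (rule order_trans[OF norm_mult_ineq])
          (intro mult_left_mono UCP_norm_le[OF ucp] norm_ge_zero)
      finally show ?thesis using k N[OF that] by linarith
    qed
    then show "\<exists>N. \<forall>n\<ge>N. norm (\<phi> n (l * c) - l * \<phi> n c - 0) < e" by auto
  qed
qed

text \<open>The scalar is absorbed into the test operator: (d a) c = a (d c).\<close>

lemma asymptotic_multiplier_scaleC:
  assumes "asymptotic_multiplier \<phi> a"
  shows "asymptotic_multiplier \<phi> (d *\<^sub>C a)"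
  unfolding asymptotic_multiplier_def
proof
  fix c
  have "(\<lambda>n. \<phi> n (a * (d *\<^sub>C c)) - a * \<phi> n (d *\<^sub>C c)) \<longlonglongrightarrow> 0"
    using assms by (simp add: asymptotic_multiplier_def)
  moreover have "a * (d *\<^sub>C b) = (d *\<^sub>C a) * b" for b
    by (rule bop_eqI) (simp add: bop_apply_scaleC)
  ultimately show "(\<lambda>n. \<phi> n ((d *\<^sub>C a) * c) - (d *\<^sub>C a) * \<phi> n c) \<longlonglongrightarrow> 0"
    by (simp add: UCP_scaleC[OF ucp])
qed

lemma asymptotic_multiplier_tendsto:
  assumes "asymptotic_multiplier \<phi> a"
  shows "(\<lambda>n. \<phi> n a - a) \<longlonglongrightarrow> 0"
  using assms[unfolded asymptotic_multiplier_def, rule_format, of 1] by (simp add: UCP_one[OF ucp])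

end


section \<open>Hyperrigidity\<close>

text \<open>The defining conditions are stable under arbitrary intersections.\<close>

lemma cstar_subalgebra_cstar_generated: "cstar_subalgebra (cstar_generated \<G>)"
  unfolding cstar_generated_def
  by (rule hull_in) (auto simp: cstar_subalgebra_def intro: closed_Inter)

text \<open>Imposing the condition on a and on \<open>adj a\<close> together builds in stability
  under adjoints. The set is taken in \<open>\<A>\<close> rather than in its image, to be compared
  with the hull defining the generated algebra.\<close>

lemma cstar_subalgebra_asymptotic_multiplier:
  assumes ucp: "\<And>n. UCP (\<phi> n)"
    and \<pi>: "representation_on \<A> \<pi>" and A: "cstar_subalgebra \<A>" "1 \<in> \<A>"
  shows "cstar_subalgebra
    {a \<in> \<A>. asymptotic_multiplier \<phi> (\<pi> a) \<and> asymptotic_multiplier \<phi> (\<pi> (adj a))}"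
    (is "cstar_subalgebra ?S")
proof -
  note mem = cstar_subalgebra_add[OF A(1)] cstar_subalgebra_mult[OF A(1)]
    cstar_subalgebra_scaleC[OF A(1)] cstar_subalgebra_adj[OF A(1)] cstar_subalgebra_zero[OF A(1)]
  note rep = representation_on_add[OF \<pi>] representation_on_mult[OF \<pi>] representation_on_scaleC[OF \<pi>]
  have "\<pi> 0 = 0" using rep(1)[OF mem(5) mem(5)] by simp
  then have "0 \<in> ?S" using mem by (simp add: asymptotic_multiplier_zero[OF ucp])
  moreover have "a + b \<in> ?S \<and> a * b \<in> ?S" if "a \<in> ?S" "b \<in> ?S" for a b
    using that mem by (simp add: rep adj_add adj_mult asymptotic_multiplier_add[OF ucp]
        asymptotic_multiplier_mult[OF ucp])
  moreover have "c *\<^sub>C a \<in> ?S" if "a \<in> ?S" for a c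
    using that mem by (simp add: rep adj_scaleC asymptotic_multiplier_scaleC[OF ucp])
  moreover have "adj a \<in> ?S" if "a \<in> ?S" for a
    using that mem by simp
  moreover have "closed ?S"
    unfolding closed_sequential_limits
  proof (intro allI impI)
    fix a l assume "(\<forall>n. a n \<in> ?S) \<and> a \<longlonglongrightarrow> l"
    then have aS: "\<And>n. a n \<in> ?S" and lim: "a \<longlonglongrightarrow> l" by blast+
    from aS have aA: "a n \<in> \<A>" for n by blast
    then have lA: "l \<in> \<A>"
      using cstar_subalgebra_closed[OF A(1)] lim closed_sequentially by metis
    \<comment> \<open>Contractivity on differences makes \<pi> continuous on \<open>\<A>\<close>;
      this is needed for the given sequence and for its adjoints.\<close>
    have cont: "(\<lambda>n. \<pi> (b n)) \<longlonglongrightarrow> \<pi> m"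
      if "b \<longlonglongrightarrow> m" and b: "\<And>n. b n \<in> \<A>" and m: "m \<in> \<A>" for b m
    proof -
      have "(\<lambda>n. \<pi> (b n) - \<pi> m) \<longlonglongrightarrow> 0"
      proof (rule Lim_null_comparison)
        show "(\<lambda>n. norm (b n - m)) \<longlonglongrightarrow> 0"
          using that(1) by (simp add: LIM_zero tendsto_norm_zero)
        have "norm (\<pi> (b n) - \<pi> m) \<le> norm (b n - m)" for n
          using norm_representation_on_le[OF \<pi> A cstar_subalgebra_diff[OF A(1) b m]]
          by (simp add: representation_on_diff[OF \<pi> A(1) b m])
        then show "\<forall>\<^sub>F n in sequentially. norm (\<pi> (b n) - \<pi> m) \<le> norm (b n - m)" by simp
      qed
      then show ?thesis by (rule LIM_zero_cancel)
    qed
    have "asymptotic_multiplier \<phi> (\<pi> l)"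
      by (rule asymptotic_multiplier_limit[OF ucp _ cont[OF lim aA lA]]) (use aS in blast)
    moreover have "(\<lambda>n. adj (a n)) \<longlonglongrightarrow> adj l"
      by (rule bounded_linear.tendsto[OF bounded_linear_adj lim])
    from asymptotic_multiplier_limit[of \<phi>, OF ucp _ cont[OF this mem(4)[OF aA] mem(4)[OF lA]]]
    have "asymptotic_multiplier \<phi> (\<pi> (adj l))" using aS by blast
    ultimately show "l \<in> ?S" using lA by simp
  qed
  ultimately show ?thesis unfolding cstar_subalgebra_def by blast
qed

theorem corollary4p3:
  fixes T :: "'h::chilbert_space bop" and \<A> \<G> :: "'h bop set"
  assumes "separable_space (euclidean :: 'h topology)"
    and "unitary T"
    and "\<A> = cstar_generated {T}"
    and "\<G> = {T}"
  shows "hyperrigid_generator TYPE('l::chilbert_space) \<A> \<G>"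
  unfolding hyperrigid_generator_def
proof (intro conjI allI impI ballI)
  show "countable \<G>" "cstar_generated \<G> = \<A>" using assms by simp_all
next
  fix \<pi> :: "'h bop \<Rightarrow> 'l bop" and \<phi> :: "nat \<Rightarrow> 'l bop \<Rightarrow> 'l bop"
  assume faithful: "faithful_representation_on \<A> \<pi>" and "\<forall>n. UCP (\<phi> n)"
    and lim: "\<forall>g\<in>\<G>. (\<lambda>n. norm (\<phi> n (\<pi> g) - \<pi> g)) \<longlonglongrightarrow> 0"
  then have ucp: "UCP (\<phi> n)" for n by blast
  have A: "cstar_subalgebra \<A>"
    unfolding assms by (rule cstar_subalgebra_cstar_generated)
  have T: "T \<in> \<A>" unfolding assms cstar_generated_def by (rule hull_inc) simp
  have T': "adj T \<in> \<A>" using A T by (rule cstar_subalgebra_adj)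
  have TT: "adj T * T = 1" "T * adj T = 1" using assms(2) by (simp_all add: unitary_def)
  \<comment> \<open>Unitarity of T makes \<open>\<A>\<close> unital, so nondegeneracy of \<pi> gives
    \<pi> 1 = 1 and \<pi> T is again unitary.\<close>
  have one: "1 \<in> \<A>" using cstar_subalgebra_mult[OF A T' T] by (simp add: TT)
  have \<pi>: "representation_on \<A> \<pi>" using faithful by (simp add: faithful_representation_on_def)
  have \<pi>1: "\<pi> 1 = 1" using representation_on_unit[OF \<pi> one] by simp
  have \<pi>adj: "\<pi> (adj T) = adj (\<pi> T)" using \<pi> T by (rule representation_on_adj)
  have iso: "adj (\<pi> T) * \<pi> T = 1" "\<pi> T * adj (\<pi> T) = 1"
    using representation_on_mult[OF \<pi> T' T] representation_on_mult[OF \<pi> T T']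
    by (simp_all add: TT \<pi>1 \<pi>adj)
  have limT: "(\<lambda>n. \<phi> n (\<pi> T)) \<longlonglongrightarrow> \<pi> T"
    using lim assms(4) by (simp add: tendsto_norm_zero_iff LIM_zero_iff)
  then have "(\<lambda>n. adj (\<phi> n (\<pi> T))) \<longlonglongrightarrow> adj (\<pi> T)"
    by (rule bounded_linear.tendsto[OF bounded_linear_adj])
  then have "(\<lambda>n. \<phi> n (adj (\<pi> T))) \<longlonglongrightarrow> adj (\<pi> T)"
    by (simp add: UCP_adj[OF ucp])
  \<comment> \<open>The multiplier obtained is the adjoint of the isometry put in, so here V is
    \<open>adj (\<pi> T)\<close>, an isometry because
    \<open>\<pi> T * adj (\<pi> T) = 1\<close>.\<close>
  then have "asymptotic_multiplier \<phi> (\<pi> T)"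
    using asymptotic_multiplier_adj_isometry[OF ucp, of "adj (\<pi> T)"] iso by simp
  moreover have "asymptotic_multiplier \<phi> (\<pi> (adj T))"
    unfolding \<pi>adj using ucp iso(1) limT by (rule asymptotic_multiplier_adj_isometry)
  \<comment> \<open>Minimality of the generated algebra: the right-hand side is a C*-subalgebra
    containing T.\<close>
  ultimately have "\<A> \<subseteq> {a \<in> \<A>. asymptotic_multiplier \<phi> (\<pi> a) \<and> asymptotic_multiplier \<phi> (\<pi> (adj a))}"
    using T cstar_subalgebra_asymptotic_multiplier[OF ucp \<pi> A one]
    unfolding assms(3) cstar_generated_def by (intro hull_minimal) auto
  then have *: "asymptotic_multiplier \<phi> (\<pi> a)" if "a \<in> \<A>" for a
    using that by blast
  fix a assume "a \<in> \<A>"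
  then show "(\<lambda>n. norm (\<phi> n (\<pi> a) - \<pi> a)) \<longlonglongrightarrow> 0"
    using asymptotic_multiplier_tendsto[of \<phi>, OF ucp *] by (intro tendsto_norm_zero)
qed

end
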